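(* Let $\sigma$ and $\tau$ be the substitutions on $\{0,1\}$ defined by $\sigma(0)=01$, $\sigma(1)=100110$ and $\tau(0)=011001$, $\tau(1)=10$, and let $u=\sigma^\infty(0)$ be the fixed point of $\sigma$ starting with $0$. Let $\mathrm{Stab}(u)$ be the set of substitutions $\varphi$ on $\{0,1\}$ with $\varphi(u)=u$. Then $$\mathrm{Stab}(u)=\{\sigma^i,\ \tau^j,\ \sigma\circ\tau^k,\ \tau\circ\sigma^\ell \mid i,j,k,\ell\in\mathbb{N}\}.$$
   Context: A substitution on $\{0,1\}$ is a non-erasing monoid morphism $\{0,1\}^*\to\{0,1\}^*$, acting letter by letter on infinite words. $\sigma^\infty(0)$ denotes the unique infinite word having all $\sigma^n(0)$ as prefixes. $\mathbb{N}$ includes $0$, and $\sigma^0$ is the identity. *)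

theory Defs
  imports Main "HOL-Library.Stream"
begin

datatype letter = L0 | L1

definition substitution :: "(letter list \<Rightarrow> letter list) \<Rightarrow> bool" where
  "substitution \<phi> \<longleftrightarrow>
     \<phi> [] = [] \<and> (\<forall>v w. \<phi> (v @ w) = \<phi> v @ \<phi> w) \<and> (\<forall>w. w \<noteq> [] \<longrightarrow> \<phi> w \<noteq> [])"

text \<open>The infinite concatenation of the images of the letters; \<^const>\<open>flat\<close> concatenates
  correctly only when all the words are nonempty, i.e. for non-erasing \<open>\<phi>\<close>.\<close>

definition subst_stream :: "(letter list \<Rightarrow> letter list) \<Rightarrow> letter stream \<Rightarrow> letter stream" where
  "subst_stream \<phi> x = flat (smap (\<lambda>a. \<phi> [a]) x)"

definition morphism_of :: "letter list \<Rightarrow> letter list \<Rightarrow> letter list \<Rightarrow> letter list" where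
  "morphism_of a b w = concat (map (\<lambda>c. case c of L0 \<Rightarrow> a | L1 \<Rightarrow> b) w)"

definition limit_word :: "(letter list \<Rightarrow> letter list) \<Rightarrow> letter \<Rightarrow> letter stream" where
  "limit_word \<phi> a =
     (THE x. \<forall>n. stake (length ((\<phi> ^^ n) [a])) x = (\<phi> ^^ n) [a])"

definition Stab :: "letter stream \<Rightarrow> (letter list \<Rightarrow> letter list) set" where
  "Stab x = {\<phi>. substitution \<phi> \<and> subst_stream \<phi> x = x}"

definition \<sigma> :: "letter list \<Rightarrow> letter list" where
  "\<sigma> = morphism_of [L0, L1] [L1, L0, L0, L1, L1, L0]"

definition \<tau> :: "letter list \<Rightarrow> letter list" where
  "\<tau> = morphism_of [L0, L1, L1, L0, L0, L1] [L1, L0]"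

definition u :: "letter stream" where
  "u = limit_word \<sigma> L0"

end

theory Submission
  imports Defs
begin

text \<open>Let \<open>\<mu>\<close> be the Thue-Morse morphism \<open>0 \<mapsto> 01, 1 \<mapsto> 10\<close> and let \<open>v\<close> be the fixed point of
  \<open>\<rho>: 0 \<mapsto> 0101, 1 \<mapsto> 1010\<close>, so that \<open>v\<^sub>n\<close> is the parity of the base-4 digit sum of \<open>n\<close>. With
  \<open>s: 0 \<mapsto> 0, 1 \<mapsto> 101\<close> and \<open>t: 0 \<mapsto> 010, 1 \<mapsto> 1\<close> one has \<open>\<sigma> = \<mu>s\<close>, \<open>\<tau> = \<mu>t\<close> and \<open>s\<mu> = t\<mu> = \<rho>\<close>;
  hence \<open>u = \<mu>(v)\<close> and \<open>\<sigma>\<tau> = \<tau>\<^sup>2\<close>.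

  A repeated letter in \<open>\<mu>(z)\<close> or \<open>\<rho>(z)\<close> straddles two blocks. So if \<open>\<phi>(u) = \<mu>(v)\<close> and some \<open>\<phi>(c)\<close>
  contains a repeated letter, all occurrences of \<open>\<phi>(c)\<close> in \<open>\<phi>(u)\<close> start at the same residue modulo 2;
  comparing the first few of them, both image lengths are even and \<open>\<phi> = \<mu>\<psi>\<close> with \<open>\<psi>(u) = v\<close>.
  In the same way, modulo 4, \<open>\<psi> = \<rho>\<psi>'\<close> with \<open>\<psi>'(u) = v\<close>, so that \<open>\<phi> = \<mu>\<rho>\<psi>' = \<sigma>(\<mu>\<psi>')\<close> and
  \<open>\<mu>\<psi>'\<close> is a shorter element of the stabiliser. Without repeated letters the images are bounded by
  the first repetitions in \<open>u\<close> and \<open>v\<close>, and inspection leaves \<open>\<phi> = id\<close>, \<open>\<psi> = s\<close> and \<open>\<psi> = t\<close>.\<close>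

section \<open>Morphisms on finite and infinite words\<close>

lemma morphism_of_Nil [simp]: "morphism_of a b [] = []"
  and morphism_of_Cons: "morphism_of a b (c # w) = (case c of L0 \<Rightarrow> a | L1 \<Rightarrow> b) @ morphism_of a b w"
  and morphism_of_append: "morphism_of a b (v @ w) = morphism_of a b v @ morphism_of a b w"
  by (simp_all add: morphism_of_def)

lemma morphism_of_L0 [simp]: "morphism_of a b (L0 # w) = a @ morphism_of a b w"
  and morphism_of_L1 [simp]: "morphism_of a b (L1 # w) = b @ morphism_of a b w"
  by (simp_all add: morphism_of_Cons)

lemma morphism_of_comp:
  "morphism_of a b \<circ> morphism_of c d = morphism_of (morphism_of a b c) (morphism_of a b d)"
proof
  fix w show "(morphism_of a b \<circ> morphism_of c d) w = morphism_of (morphism_of a b c) (morphism_of a b d) w"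
  proof (induction w)
    case (Cons x w) then show ?case by (cases x) (auto simp: morphism_of_append)
  qed simp
qed

lemma morphism_of_id: "morphism_of [L0] [L1] = id"
proof
  fix w show "morphism_of [L0] [L1] w = id w"
  proof (induction w)
    case (Cons x w) then show ?case by (cases x) auto
  qed simp
qed

lemma substitution_morphism_of: "a \<noteq> [] \<Longrightarrow> b \<noteq> [] \<Longrightarrow> substitution (morphism_of a b)"
  unfolding substitution_def
  by (auto simp: morphism_of_append morphism_of_Cons neq_Nil_conv split: letter.splits)

lemma substitution_eq_morphism_of:
  assumes "substitution \<phi>"
  shows "\<phi> = morphism_of (\<phi> [L0]) (\<phi> [L1])"
proof
  fix w show "\<phi> w = morphism_of (\<phi> [L0]) (\<phi> [L1]) w"
  proof (induction w)
    case Nil then show ?case using assms by (simp add: substitution_def)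
  next
    case (Cons x w)
    have "\<phi> (x # w) = \<phi> [x] @ \<phi> w"
      using assms by (metis append_Cons append_Nil substitution_def)
    with Cons show ?case by (cases x) auto
  qed
qed

lemma substitution_nonempty: "substitution \<phi> \<Longrightarrow> \<phi> [c] \<noteq> []"
  by (simp add: substitution_def)

lemma substitution_append: "substitution \<phi> \<Longrightarrow> \<phi> (v @ w) = \<phi> v @ \<phi> w"
  by (simp add: substitution_def)

lemma substitution_id: "substitution id"
  by (simp add: substitution_def)

lemma substitution_comp: "substitution f \<Longrightarrow> substitution g \<Longrightarrow> substitution (f \<circ> g)"
  by (simp add: substitution_def)

section \<open>Action of a substitution on infinite words\<close>

lemma subst_stream_SCons:
  assumes "substitution \<phi>"
  shows "subst_stream \<phi> (c ## s) = \<phi> [c] @- subst_stream \<phi> s"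
  using substitution_nonempty[OF assms, of c]
  by (simp add: subst_stream_def flat_unfold)

lemma subst_stream_shift:
  assumes "substitution \<phi>"
  shows "subst_stream \<phi> (w @- s) = \<phi> w @- subst_stream \<phi> s"
proof (induction w)
  case Nil
  then show ?case using assms by (simp add: substitution_def)
next
  case (Cons c w)
  have "\<phi> (c # w) = \<phi> [c] @ \<phi> w"
    using substitution_append[OF assms, of "[c]" w] by simp
  with Cons show ?case by (simp add: subst_stream_SCons[OF assms])
qed

lemma length_substitution_ge: "substitution \<phi> \<Longrightarrow> length w \<le> length (\<phi> w)"
proof (induction w)
  case (Cons c w)
  have "\<phi> (c # w) = \<phi> [c] @ \<phi> w"
    using substitution_append[OF Cons.prems, of "[c]" w] by simp
  with Cons substitution_nonempty[OF Cons.prems, of c] show ?case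
    by (cases "\<phi> [c]") auto
qed simp

lemma stake_eqI:
  assumes "\<And>n. \<exists>k\<ge>n. stake k s = stake k t"
  shows "s = t"
proof -
  have "s !! n = t !! n" for n
    using assms[of "Suc n"] by (metis Suc_le_lessD stake_nth)
  then show ?thesis
    by (metis ext stream_smap_nats)
qed

lemma stake_length_shift: "stake (length w) (w @- s) = w"
  by (simp add: stake_shift)

lemma stake_subst_stream:
  assumes "substitution \<phi>"
  shows "stake (length (\<phi> (stake n s))) (subst_stream \<phi> s) = \<phi> (stake n s)"
  using subst_stream_shift[OF assms, of "stake n s" "sdrop n s"]
  by (simp add: stake_sdrop stake_length_shift)

text \<open>Substitutions do not shorten words, so \<open>f (g (stake n s))\<close> is a common
  prefix of length at least \<open>n\<close>.\<close>

lemma subst_stream_comp: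
  assumes "substitution f" "substitution g"
  shows "subst_stream (f \<circ> g) s = subst_stream f (subst_stream g s)"
proof (rule stake_eqI)
  fix n
  let ?w = "f (g (stake n s))"
  have "n \<le> length ?w"
    using length_substitution_ge[OF assms(2), of "stake n s"]
      length_substitution_ge[OF assms(1), of "g (stake n s)"] by simp
  moreover have "subst_stream (f \<circ> g) s = ?w @- subst_stream (f \<circ> g) (sdrop n s)"
    using subst_stream_shift[OF substitution_comp[OF assms], of "stake n s" "sdrop n s"]
    by (simp add: stake_sdrop)
  moreover have "subst_stream f (subst_stream g s) = ?w @- subst_stream f (subst_stream g (sdrop n s))"
    using subst_stream_shift[OF assms(2), of "stake n s" "sdrop n s"]
      subst_stream_shift[OF assms(1), of "g (stake n s)"]
    by (simp add: stake_sdrop)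
  ultimately show "\<exists>k\<ge>n. stake k (subst_stream (f \<circ> g) s) = stake k (subst_stream f (subst_stream g s))"
    by (metis stake_length_shift)
qed

lemma subst_stream_id: "subst_stream id s = s"
proof (rule stake_eqI)
  fix n show "\<exists>k\<ge>n. stake k (subst_stream id s) = stake k s"
    using stake_subst_stream[OF substitution_id, of n s] by auto
qed

section \<open>The stabiliser as a monoid, and limit words\<close>

lemma Stab_id: "id \<in> Stab x"
  by (simp add: Stab_def substitution_id subst_stream_id)

lemma Stab_comp: "f \<in> Stab x \<Longrightarrow> g \<in> Stab x \<Longrightarrow> f \<circ> g \<in> Stab x"
  by (simp add: Stab_def substitution_comp subst_stream_comp)

lemma Stab_funpow: "f \<in> Stab x \<Longrightarrow> f ^^ n \<in> Stab x"
  by (induction n) (auto intro: Stab_id Stab_comp)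

text \<open>Resolves the definite description in \<open>limit_word\<close>: a fixed word starting
  with \<open>a\<close> has every \<open>(\<phi> ^^ n) [a]\<close> as a prefix, and the growth of
  these prefixes forces uniqueness.\<close>

lemma Stab_limit_word:
  assumes "\<phi> \<in> Stab x" "shd x = a"
    and grow: "\<And>n. n \<le> length ((\<phi> ^^ n) [a])"
  shows "limit_word \<phi> a = x"
proof -
  have pre: "stake (length ((\<phi> ^^ n) [a])) x = (\<phi> ^^ n) [a]" for n
  proof -
    have "\<phi> ^^ n \<in> Stab x" using assms(1) by (rule Stab_funpow)
    then show ?thesis
      using stake_subst_stream[of "\<phi> ^^ n" 1 x] assms(2) by (simp add: Stab_def)
  qed
  show ?thesis unfolding limit_word_def
  proof (rule the_equality)
    show "\<forall>n. stake (length ((\<phi> ^^ n) [a])) x = (\<phi> ^^ n) [a]" using pre by blast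
    fix y assume "\<forall>n. stake (length ((\<phi> ^^ n) [a])) y = (\<phi> ^^ n) [a]"
    then show "y = x"
      by (intro stake_eqI) (metis pre grow)
  qed
qed

section \<open>Uniform morphisms\<close>

text \<open>The condition on position 0 lets a preimage be read off at the multiples of
  \<open>m\<close>, which makes \<open>q\<close> injective on infinite words.\<close>

definition uniform :: "nat \<Rightarrow> (letter list \<Rightarrow> letter list) \<Rightarrow> bool" where
  "uniform m q \<longleftrightarrow> 0 < m \<and> substitution q \<and> (\<forall>c. length (q [c]) = m \<and> q [c] ! 0 = c)"

lemma uniform_length:
  assumes "uniform m q"
  shows "length (q w) = m * length w"
proof (induction w)
  case Nil then show ?case using assms by (simp add: uniform_def substitution_def)
next
  case (Cons c w)
  have "q (c # w) = q [c] @ q w"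
    using assms substitution_append[of q "[c]" w] by (simp add: uniform_def)
  with Cons assms show ?case by (simp add: uniform_def)
qed

lemma subst_stream_uniform_nth:
  assumes "uniform m q" "d < m"
  shows "subst_stream q z !! (m * n + d) = q [z !! n] ! d"
proof -
  have q: "substitution q" and len: "length (q [c]) = m" for c
    using assms(1) by (auto simp: uniform_def)
  have "subst_stream q z = q (stake n z) @- q [z !! n] @- subst_stream q (sdrop (Suc n) z)"
    using subst_stream_shift[OF q, of "stake n z" "sdrop n z"]
      subst_stream_SCons[OF q, of "z !! n" "sdrop (Suc n) z"]
    by (metis id_stake_snth_sdrop subst_stream_shift[OF q] subst_stream_SCons[OF q])
  then show ?thesis
    using assms(2) by (simp add: uniform_length[OF assms(1)] shift_snth_ge shift_snth_less len)
qed

lemma subst_stream_uniform_inj: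
  assumes "uniform m q" "subst_stream q y = subst_stream q z"
  shows "y = z"
proof -
  have "y !! n = z !! n" for n
    using assms subst_stream_uniform_nth[OF assms(1), of 0 _ n]
    by (metis uniform_def)
  then show ?thesis by (metis ext stream_smap_nats)
qed

text \<open>A factor that starts and ends at block boundaries consists of whole blocks.\<close>

lemma uniform_factor:
  assumes "uniform m q" "subst_stream q z = a @- b @- s" "m dvd length a" "m dvd length b"
  obtains b' where "b = q b'"
proof -
  obtain i j where ij: "length a = m * i" "length b = m * j" using assms(3,4) by (auto elim!: dvdE)
  have q: "substitution q" using assms(1) by (simp add: uniform_def)
  let ?a = "q (stake i z)" and ?b = "q (stake j (sdrop i z))"
  have "subst_stream q z = ?a @- ?b @- subst_stream q (sdrop j (sdrop i z))"
    by (metis stake_sdrop subst_stream_shift[OF q])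
  then have "stake (length (a @ b)) (a @- b @- s) = stake (length (?a @ ?b)) (?a @- ?b @- subst_stream q (sdrop j (sdrop i z)))"
    using ij assms(2) by (simp add: uniform_length[OF assms(1)])
  then have "a @ b = ?a @ ?b"
    by (metis shift_append stake_length_shift)
  then have "b = ?b" using ij by (simp add: uniform_length[OF assms(1)])
  then show ?thesis by (rule that)
qed

section \<open>Synchronisation by repeated letters\<close>

text \<open>Equal neighbours mark a block boundary: the second of them sits at a multiple of
  \<open>m\<close>.\<close>

definition synchronised :: "nat \<Rightarrow> letter stream \<Rightarrow> bool" where
  "synchronised m w \<longleftrightarrow> (\<forall>i. w !! i = w !! Suc i \<longrightarrow> m dvd Suc i)"

definition has_double :: "letter list \<Rightarrow> bool" where
  "has_double x \<longleftrightarrow> (\<exists>i. Suc i < length x \<and> x ! i = x ! Suc i)"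

text \<open>A repeated letter has the same offset in each occurrence of \<open>x\<close> and fixes
  the starting position modulo \<open>m\<close>.\<close>

lemma synchronised_occurrences:
  assumes "synchronised m w" "has_double x"
    and "w = a @- x @- s" "w = b @- x @- t" "length b = length a + d"
  shows "m dvd d"
proof -
  obtain i where i: "Suc i < length x" "x ! i = x ! Suc i"
    using assms(2) by (auto simp: has_double_def)
  have *: "m dvd Suc (length c + i)" if "w = c @- x @- r" for c r
  proof -
    have "w !! (length c + i) = x ! i" "w !! (length c + Suc i) = x ! Suc i"
      using i(1) by (auto simp: that shift_snth_ge shift_snth_less simp del: snth.simps)
    then show ?thesis using assms(1) i(2) by (auto simp: synchronised_def simp del: snth.simps)
  qed
  have "Suc (length b + i) = Suc (length a + i) + d" using assms(5) by simp
  then show ?thesis using *[OF assms(3)] *[OF assms(4)]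
    by (metis dvd_add_right_iff)
qed

text \<open>The factorisation of \<open>w\<close> follows the first 12 letters of \<open>u\<close>.
  Distances between occurrences of one word are combinations of the two lengths, and three of them
  suffice to isolate both.\<close>

lemma dvd_lengths:
  fixes x y :: "letter list"
  assumes "synchronised m w" "has_double x \<or> has_double y"
    and w: "w = x @- y @- y @- x @- x @- y @- y @- x @- y @- x @- x @- y @- r"
  shows "m dvd length x" "m dvd length y"
proof -
  let ?X = "length x" and ?Y = "length y"
  have "m dvd ?X \<and> m dvd ?Y"
  proof (cases "has_double x")
    case True
    have occ: "m dvd d" if "w = b @- x @- t" "length b = d" for b t d
      using synchronised_occurrences[OF assms(1) True, of "[]" _ b t d] w that by simp
    have "m dvd ?X + ?Y + ?Y"
      by (rule occ[of "x @ y @ y"]) (simp_all add: w)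
    moreover have "m dvd (?X + ?Y + ?Y) + ?X"
      by (rule occ[of "x @ y @ y @ x"]) (simp_all add: w)
    ultimately have X: "m dvd ?X" and Y2: "m dvd ?Y + ?Y"
      by (metis dvd_add_right_iff, metis add.assoc dvd_add_left_iff dvd_add_right_iff)
    \<comment> \<open>An occurrence of \<open>x\<close> preceded by an odd number of
      \<open>y\<close>; the grouping exposes the known multiples and leaves one
      \<open>?Y\<close>.\<close>
    have "m dvd 4 * ?X + (2 * (?Y + ?Y) + ?Y)"
      by (rule occ[of "x @ y @ y @ x @ x @ y @ y @ x @ y"]) (simp_all add: w)
    then have "m dvd ?Y"
      using X Y2 by (metis dvd_add_right_iff dvd_mult)
    with X show ?thesis by simp
  next
    case False
    then have y: "has_double y" using assms(2) by simp
    have occ: "m dvd d" if "w = b @- y @- t" "length b = ?X + d" for b t d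
      using synchronised_occurrences[OF assms(1) y, of x _ b t d] w that by simp
    have Y: "m dvd ?Y"
      by (rule occ[of "x @ y"]) (simp_all add: w)
    have "m dvd 2 * ?X + 2 * ?Y"
      by (rule occ[of "x @ y @ y @ x @ x"]) (simp_all add: w)
    then have X2: "m dvd 2 * ?X" using Y by (simp add: dvd_add_left_iff)
    \<comment> \<open>The occurrence of \<open>y\<close> at distance \<open>3 * ?X + 4 * ?Y\<close>
      from the first one: an odd multiple of \<open>?X\<close> is now available.\<close>
    have "m dvd 4 * ?Y + (2 * ?X + ?X)"
      by (rule occ[of "x @ y @ y @ x @ x @ y @ y @ x"]) (simp_all add: w)
    then have "m dvd ?X" using X2 Y by (metis dvd_add_right_iff dvd_mult)
    with Y show ?thesis by simp
  qed
  then show "m dvd length x" "m dvd length y" by auto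
qed


text \<open>Divisible lengths align the first \<open>x\<close> and the first \<open>y\<close> with
  the blocks of \<open>q\<close>, so both desubstitute; injectivity of \<open>q\<close> then cancels
  it from the equation.\<close>

lemma desubstitute:
  assumes q: "uniform m q" and sync: "synchronised m (subst_stream q z)"
    and xy: "x \<noteq> []" "y \<noteq> []" "has_double x \<or> has_double y"
    and eq: "subst_stream (morphism_of x y) s = subst_stream q z"
    and pre: "s = [L0, L1, L1, L0, L0, L1, L1, L0, L1, L0, L0, L1] @- r"
  obtains x' y' where "x' \<noteq> []" "y' \<noteq> []" "x = q x'" "y = q y'"
    "subst_stream (morphism_of x' y') s = z"
proof -
  have sub: "substitution (morphism_of x y)" using xy by (simp add: substitution_morphism_of)
  have sq: "substitution q" using q by (simp add: uniform_def)
  have w: "subst_stream q z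
      = x @- y @- y @- x @- x @- y @- y @- x @- y @- x @- x @- y @- subst_stream (morphism_of x y) r"
    unfolding eq[symmetric] pre subst_stream_shift[OF sub] by simp
  have dvd: "m dvd length x" "m dvd length y"
    using dvd_lengths[OF sync xy(3) w] by auto
  obtain x' where x': "x = q x'"
    using uniform_factor[OF q, of z "[]" x] w dvd by auto
  obtain y' where y': "y = q y'"
    using uniform_factor[OF q w] dvd by auto
  have ne: "x' \<noteq> []" "y' \<noteq> []" using xy x' y' sq by (auto simp: substitution_def)
  have sub': "substitution (morphism_of x' y')" using ne by (simp add: substitution_morphism_of)
  have "q = morphism_of (q [L0]) (q [L1])" using sq by (rule substitution_eq_morphism_of)
  then have "q \<circ> morphism_of x' y' = morphism_of x y"
    by (metis morphism_of_comp x' y')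
  then have "subst_stream q (subst_stream (morphism_of x' y') s) = subst_stream q z"
    using eq by (simp add: subst_stream_comp[OF sq sub', symmetric])
  then have "subst_stream (morphism_of x' y') s = z"
    by (rule subst_stream_uniform_inj[OF q])
  with ne x' y' show ?thesis by (rule that)
qed

lemma synchronised_subst_stream:
  assumes q: "uniform m q" and alt: "\<And>c d. Suc d < m \<Longrightarrow> q [c] ! d \<noteq> q [c] ! Suc d"
  shows "synchronised m (subst_stream q z)"
  unfolding synchronised_def
proof (intro allI impI)
  fix i assume eq: "subst_stream q z !! i = subst_stream q z !! Suc i"
  have m: "0 < m" using q by (simp add: uniform_def)
  show "m dvd Suc i"
  proof (cases "Suc (i mod m) < m")
    case True
    have "subst_stream q z !! (m * (i div m) + i mod m) = q [z !! (i div m)] ! (i mod m)"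
      "subst_stream q z !! (m * (i div m) + Suc (i mod m)) = q [z !! (i div m)] ! Suc (i mod m)"
      by (rule subst_stream_uniform_nth[OF q], use True in simp)+
    with eq alt[OF True] show ?thesis
      by (simp del: snth.simps)
  next
    case False
    then have "Suc (i mod m) = m" using mod_less_divisor[OF m, of i] by linarith
    then show ?thesis
      by (metis dvd_eq_mod_eq_0 mod_Suc)
  qed
qed

section \<open>The words \<open>u\<close> and \<open>v\<close>\<close>

definition \<mu> :: "letter list \<Rightarrow> letter list" where
  "\<mu> = morphism_of [L0, L1] [L1, L0]"

definition \<rho> :: "letter list \<Rightarrow> letter list" where
  "\<rho> = morphism_of [L0, L1, L0, L1] [L1, L0, L1, L0]"

fun flip :: "letter \<Rightarrow> letter" where
  "flip L0 = L1"
| "flip L1 = L0"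

text \<open>The last base-4 digit of \<open>n\<close> has the parity of \<open>n\<close>, so
  \<open>even n\<close> decides whether it flips the result.\<close>

fun digit_parity :: "nat \<Rightarrow> letter" where
  "digit_parity n = (if n = 0 then L0
     else if even n then digit_parity (n div 4) else flip (digit_parity (n div 4)))"

declare digit_parity.simps [simp del]

definition v :: "letter stream" where
  "v = smap digit_parity nats"

lemma uniform_\<mu>: "uniform 2 \<mu>"
  unfolding uniform_def \<mu>_def
  by (auto simp: substitution_morphism_of morphism_of_Cons split: letter.split)

lemma uniform_\<rho>: "uniform 4 \<rho>"
  unfolding uniform_def \<rho>_def
  by (auto simp: substitution_morphism_of morphism_of_Cons split: letter.split)

lemma synchronised_\<mu>: "synchronised 2 (subst_stream \<mu> z)"
proof (rule synchronised_subst_stream[OF uniform_\<mu>])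
  fix c d assume "Suc d < (2::nat)"
  then show "\<mu> [c] ! d \<noteq> \<mu> [c] ! Suc d" by (cases c) (auto simp: \<mu>_def)
qed

lemma synchronised_\<rho>: "synchronised 4 (subst_stream \<rho> z)"
proof (rule synchronised_subst_stream[OF uniform_\<rho>])
  fix c d assume "Suc d < (4::nat)"
  then have "d \<in> {0, 1, 2}" by auto
  then show "\<rho> [c] ! d \<noteq> \<rho> [c] ! Suc d" by (cases c) (auto simp: \<rho>_def)
qed

lemma digit_parity_0: "digit_parity 0 = L0"
  by (subst digit_parity.simps) simp

lemma digit_parity_4: "d < 4 \<Longrightarrow> digit_parity (4 * n + d) = \<rho> [digit_parity n] ! d"
proof -
  assume "d < 4"
  then have d: "d \<in> {0, 1, 2, 3}" by auto
  have dv: "(4 * n + d) div 4 = n" using \<open>d < 4\<close> by simp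
  have "digit_parity (4 * n + d) = (if even d then digit_parity n else flip (digit_parity n))"
  proof (cases "4 * n + d = 0")
    case True then show ?thesis by (simp add: digit_parity_0)
  next
    case False then show ?thesis
      by (subst digit_parity.simps) (simp add: dv digit_parity_0)
  qed
  also have "\<dots> = \<rho> [digit_parity n] ! d"
    using d by (cases "digit_parity n") (auto simp: \<rho>_def)
  finally show ?thesis .
qed

lemma subst_stream_\<rho>_v: "subst_stream \<rho> v = v"
proof -
  have "subst_stream \<rho> v !! k = v !! k" for k
  proof -
    have "subst_stream \<rho> v !! (4 * (k div 4) + k mod 4) = v !! (4 * (k div 4) + k mod 4)"
      using digit_parity_4[of "k mod 4" "k div 4"]
      by (subst subst_stream_uniform_nth[OF uniform_\<rho>]) (simp_all add: v_def)
    then show ?thesis by simp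
  qed
  then show ?thesis by (metis ext stream_smap_nats)
qed

lemma v_shd: "shd v = L0"
  by (simp add: v_def digit_parity_0)

lemma v_prefix:
  obtains r where "v = [L0,L1,L0,L1, L1,L0,L1,L0, L0,L1,L0,L1, L1,L0,L1,L0] @- r"
proof -
  have sub: "substitution \<rho>" using uniform_\<rho> by (simp add: uniform_def)
  have "v = [L0] @- stl v" using v_shd by (simp add: stream.expand)
  \<comment> \<open>Applying \<open>v = \<rho>(v)\<close> twice to the first letter yields 16
    letters.\<close>
  then have "v = \<rho> (\<rho> [L0]) @- subst_stream \<rho> (subst_stream \<rho> (stl v))"
    by (metis subst_stream_\<rho>_v subst_stream_shift[OF sub])
  then show ?thesis by (intro that) (simp add: \<rho>_def)
qed

text \<open>\<open>\<sigma>\<close> and \<open>\<tau>\<close> agree on the image of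
  \<open>\<mu>\<close>, where all values of \<open>\<tau>\<close> lie; hence the last
  equation.\<close>

lemma \<sigma>_\<mu>: "\<sigma> \<circ> \<mu> = \<mu> \<circ> \<rho>" and \<tau>_\<mu>: "\<tau> \<circ> \<mu> = \<mu> \<circ> \<rho>"
  and \<sigma>_\<tau>: "\<sigma> \<circ> \<tau> = \<tau> \<circ> \<tau>"
  by (simp_all add: \<sigma>_def \<tau>_def \<mu>_def \<rho>_def morphism_of_comp)

lemma substitutions:
  "substitution \<sigma>" "substitution \<tau>" "substitution \<mu>" "substitution \<rho>"
  by (simp_all add: \<sigma>_def \<tau>_def \<mu>_def \<rho>_def substitution_morphism_of)

lemma Stab_\<mu>_v:
  assumes "substitution f" "f \<circ> \<mu> = \<mu> \<circ> \<rho>"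
  shows "f \<in> Stab (subst_stream \<mu> v)"
proof -
  have "subst_stream f (subst_stream \<mu> v) = subst_stream (f \<circ> \<mu>) v"
    using assms(1) substitutions(3) by (simp only: subst_stream_comp)
  also have "\<dots> = subst_stream \<mu> v"
    using substitutions by (simp only: assms(2) subst_stream_comp subst_stream_\<rho>_v)
  finally show ?thesis using assms(1) by (simp add: Stab_def)
qed

lemma u_eq: "u = subst_stream \<mu> v"
  unfolding u_def
proof (rule Stab_limit_word)
  show "\<sigma> \<in> Stab (subst_stream \<mu> v)"
    by (rule Stab_\<mu>_v) (simp_all add: substitutions \<sigma>_\<mu>)
  show "shd (subst_stream \<mu> v) = L0"
    using subst_stream_SCons[OF substitutions(3), of L0 "stl v"] v_shd
    by (metis \<mu>_def append_Cons morphism_of_L0 shift.simps(2) stream.collapse stream.sel(1))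
  \<comment> \<open>Each letter has an image of length at least 2, so the iterates grow at least
    like \<open>2 ^ n\<close>.\<close>
  have dbl: "2 * length w \<le> length (\<sigma> w)" for w
  proof (induction w)
    case (Cons c w) then show ?case by (cases c) (auto simp: \<sigma>_def)
  qed simp
  fix n
  have "2 ^ n \<le> length ((\<sigma> ^^ n) [L0])"
  proof (induction n)
    case (Suc n) then show ?case using dbl[of "(\<sigma> ^^ n) [L0]"] by simp
  qed simp
  then show "n \<le> length ((\<sigma> ^^ n) [L0])"
    by (meson less_exp less_imp_le order_trans)
qed

lemma \<sigma>_in_Stab: "\<sigma> \<in> Stab u" and \<tau>_in_Stab: "\<tau> \<in> Stab u"
  by (simp_all add: u_eq Stab_\<mu>_v substitutions \<sigma>_\<mu> \<tau>_\<mu>)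

lemma u_prefix:
  obtains r where "u = [L0,L1,L1,L0, L0,L1,L1,L0, L1,L0,L0,L1] @- r"
proof -
  obtain r where "v = [L0,L1,L0,L1, L1,L0,L1,L0, L0,L1,L0,L1, L1,L0,L1,L0] @- r" by (rule v_prefix)
  then have "u = \<mu> [L0,L1,L0,L1, L1,L0,L1,L0, L0,L1,L0,L1, L1,L0,L1,L0] @- subst_stream \<mu> r"
    unfolding u_eq by (metis subst_stream_shift[OF substitutions(3)])
  then show ?thesis by (intro that) (simp add: \<mu>_def)
qed

section \<open>Morphisms without repeated letters\<close>

text \<open>A factor starting at or before position \<open>i\<close> must end there at the latest,
  or it would contain the double at \<open>i\<close>.\<close>

lemma no_double_length:
  assumes "w = a @- x @- s" "\<not> has_double x" "w !! i = w !! Suc i" "length a \<le> i"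
  shows "length a + length x \<le> Suc i"
proof (rule ccontr)
  assume "\<not> ?thesis"
  then obtain k where k: "i = length a + k" "Suc k < length x"
    using assms(4) by (metis add_Suc_right le_Suc_ex not_le nat_add_left_cancel_less)
  have "w !! (length a + k) = x ! k" "w !! (length a + Suc k) = x ! Suc k"
    using k(2) by (auto simp: assms(1) shift_snth_ge shift_snth_less simp del: snth.simps)
  then show False
    using assms(2,3) k by (auto simp: has_double_def simp del: snth.simps)
qed

lemma prefix_eq_take:
  assumes "w = x @- s" "w = p @- t" "length x \<le> length p"
  shows "x = take (length x) p"
proof -
  have "x = stake (length x) w" using assms(1) by (simp add: stake_length_shift)
  also have "\<dots> = take (length x) (stake (length p) w)"
    using assms(3) by (simp add: take_stake min_absorb1)
  also have "stake (length p) w = p" using assms(2) by (simp add: stake_length_shift)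
  finally show ?thesis .
qed

lemma two_prefixes_eq_take:
  assumes "w = x @- y @- s" "w = p @- t" "length x + length y \<le> length p"
  shows "x = take (length x) p" "y = take (length y) (drop (length x) p)"
proof -
  have "x @ y = take (length x + length y) p"
    using prefix_eq_take[of w "x @ y" s p t] assms by simp
  then have "x @ y = take (length x) p @ take (length y) (drop (length x) p)"
    by (simp add: take_add)
  moreover have "length (take (length x) p) = length x" using assms(3) by simp
  ultimately show "x = take (length x) p" "y = take (length y) (drop (length x) p)"
    by (metis append_eq_append_conv)+
qed

lemma no_double_\<mu>:
  assumes xy: "x \<noteq> []" "y \<noteq> []" "\<not> has_double x" "\<not> has_double y"
    and eq: "subst_stream (morphism_of x y) u = u"
  shows "x = [L0] \<and> y = [L1]"
proof -
  obtain r where r: "u = [L0,L1,L1,L0, L0,L1,L1,L0, L1,L0,L0,L1] @- r" by (rule u_prefix)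
  have sub: "substitution (morphism_of x y)" using xy by (simp add: substitution_morphism_of)
  have "u = [L0,L1,L1] @- sdrop 3 u" unfolding r by (simp add: eval_nat_numeral)
  from arg_cong[OF this, of "subst_stream (morphism_of x y)"]
  obtain s where s: "u = x @- y @- y @- s"
    unfolding subst_stream_shift[OF sub] eq using that by simp
  \<comment> \<open>The first two doubles of \<open>u\<close>; they bound the ends of
    \<open>x\<close> and of the first \<open>y\<close>.\<close>
  have "u !! 1 = u !! Suc 1" "u !! 3 = u !! Suc 3"
    unfolding r by (simp_all add: eval_nat_numeral)
  note doubles = this
  have "length x \<le> 2"
    using no_double_length[of u "[]" x "y @- y @- s" 1, OF _ xy(3) doubles(1)] s by simp
  moreover from this have "length x + length y \<le> 4"
    using no_double_length[OF s xy(4) doubles(2)] by simp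
  moreover have "length x \<noteq> 0" "length y \<noteq> 0" using xy by auto
  ultimately have lens: "length x \<in> {1, 2}" "length y \<in> {1, 2, 3}" and le: "length x + length y \<le> 12"
    unfolding insert_iff by arith+
  obtain m n where mn: "m \<in> {1, 2}" "n \<in> {1, 2, 3}"
    and x: "x = take m [L0,L1,L1,L0, L0,L1,L1,L0, L1,L0,L0,L1]"
    and y: "y = take n (drop m [L0,L1,L1,L0, L0,L1,L1,L0, L1,L0,L0,L1])"
    using that[OF lens] two_prefixes_eq_take[OF s r] le by simp
  have main: "x @- y @- y @- s = [L0,L1,L1,L0, L0,L1,L1,L0, L1,L0,L0,L1] @- r"
    using s r by simp
  \<comment> \<open>Six candidate pairs remain, and the second copy of \<open>y\<close> refutes all
    but one.\<close>
  show ?thesis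
    using mn main unfolding x y
    by (elim insertE emptyE; simp)
qed

lemma no_double_\<rho>:
  assumes xy: "x \<noteq> []" "y \<noteq> []" "\<not> has_double x" "\<not> has_double y"
    and eq: "subst_stream (morphism_of x y) u = v"
  shows "x = [L0] \<and> y = [L1, L0, L1] \<or> x = [L0, L1, L0] \<and> y = [L1]"
proof -
  let ?p = "[L0,L1,L0,L1, L1,L0,L1,L0, L0,L1,L0,L1, L1,L0,L1,L0]"
  obtain q where q: "u = [L0,L1,L1,L0, L0,L1,L1,L0, L1,L0,L0,L1] @- q" by (rule u_prefix)
  obtain r where r: "v = ?p @- r" by (rule v_prefix)
  have sub: "substitution (morphism_of x y)" using xy by (simp add: substitution_morphism_of)
  \<comment> \<open>Five letters are taken because \<open>x = 0101\<close>, \<open>y = 10\<close>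
    agrees with \<open>v\<close> throughout \<open>xyyx\<close> and fails only at the next
    \<open>x\<close>.\<close>
  have "u = [L0,L1,L1,L0,L0] @- sdrop 5 u" unfolding q by (simp add: eval_nat_numeral)
  from arg_cong[OF this, of "subst_stream (morphism_of x y)"]
  obtain s where s: "v = x @- y @- y @- x @- x @- s"
    unfolding subst_stream_shift[OF sub] eq using that by simp
  have "v !! 3 = v !! Suc 3" "v !! 7 = v !! Suc 7"
    unfolding r by (simp_all add: eval_nat_numeral)
  note doubles = this
  have "length x \<le> 4"
    using no_double_length[of v "[]" x _ 3, OF _ xy(3) doubles(1)] s by simp
  moreover from this have "length x + length y \<le> 8"
    using no_double_length[OF s xy(4) doubles(2)] by simp
  moreover have "length x \<noteq> 0" "length y \<noteq> 0" using xy by auto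
  ultimately have lens: "length x \<in> {1, 2, 3, 4}" "length y \<in> {1, 2, 3, 4, 5, 6, 7}"
    and le: "length x + length y \<le> 16"
    unfolding insert_iff by arith+
  obtain m n where mn: "m \<in> {1, 2, 3, 4}" "n \<in> {1, 2, 3, 4, 5, 6, 7}"
    and x: "x = take m ?p" and y: "y = take n (drop m ?p)"
    using that[OF lens] two_prefixes_eq_take[OF s r] le by simp
  have main: "x @- y @- y @- x @- x @- s = ?p @- r"
    using s r by simp
  show ?thesis
    using mn main unfolding x y
    by (elim insertE emptyE; simp)
qed

section \<open>The stabiliser\<close>

text \<open>Descent on the length of \<open>\<phi> [L0]\<close>: peeling off one
  \<open>\<sigma>\<close> on the left gives a shorter element. The powers of \<open>\<sigma>\<close>
  and \<open>\<tau>\<close> together are closed under composing with \<open>\<sigma>\<close> on the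
  left.\<close>

lemma Stab_u_cases:
  assumes "\<phi> \<in> Stab u"
  shows "(\<exists>i. \<phi> = \<sigma> ^^ i) \<or> (\<exists>j. \<phi> = \<tau> ^^ j)"
  using assms
proof (induction "length (\<phi> [L0])" arbitrary: \<phi> rule: less_induct)
  case less
  define a b where "a = \<phi> [L0]" and "b = \<phi> [L1]"
  have sub: "substitution \<phi>" and fix_u: "subst_stream \<phi> u = u"
    using less.prems by (auto simp: Stab_def)
  have ab: "a \<noteq> []" "b \<noteq> []" using sub by (auto simp: a_def b_def substitution_nonempty)
  have \<phi>: "\<phi> = morphism_of a b" unfolding a_def b_def by (rule substitution_eq_morphism_of[OF sub])
  obtain r where r: "u = [L0,L1,L1,L0, L0,L1,L1,L0, L1,L0,L0,L1] @- r" by (rule u_prefix)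
  show ?case
  proof (cases "has_double a \<or> has_double b")
    case False
    then have "\<phi> = \<sigma> ^^ 0"
      using no_double_\<mu>[OF ab] fix_u \<phi> by (auto simp: morphism_of_id)
    then show ?thesis by blast
  next
    case True
    have "subst_stream (morphism_of a b) u = subst_stream \<mu> v"
      using fix_u \<phi> u_eq by simp
    then obtain x y where xy: "x \<noteq> []" "y \<noteq> []" "a = \<mu> x" "b = \<mu> y"
      "subst_stream (morphism_of x y) u = v"
      using desubstitute[OF uniform_\<mu> synchronised_\<mu> ab True _ r] by metis
    show ?thesis
    proof (cases "has_double x \<or> has_double y")
      case False
      then have "x = [L0] \<and> y = [L1, L0, L1] \<or> x = [L0, L1, L0] \<and> y = [L1]"
        using no_double_\<rho> xy by blast
      then have "\<phi> = \<sigma> ^^ 1 \<or> \<phi> = \<tau> ^^ 1"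
        using \<phi> xy by (auto simp: \<mu>_def \<sigma>_def \<tau>_def)
      then show ?thesis by blast
    next
      case True
      have "subst_stream (morphism_of x y) u = subst_stream \<rho> v"
        using xy subst_stream_\<rho>_v by simp
      then obtain x' y' where xy': "x' \<noteq> []" "y' \<noteq> []" "x = \<rho> x'" "y = \<rho> y'"
        "subst_stream (morphism_of x' y') u = v"
        using desubstitute[OF uniform_\<rho> synchronised_\<rho> xy(1,2) True _ r] by metis
      \<comment> \<open>Dropping \<open>\<rho>\<close> divides both image lengths by 4. The outer
        \<open>\<mu>\<close> stays, so that \<open>u = \<mu>(v)\<close> is fixed again.\<close>
      define \<psi> where "\<psi> = \<mu> \<circ> morphism_of x' y'"
      have sub': "substitution (morphism_of x' y')" using xy' by (simp add: substitution_morphism_of)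
      have "\<psi> \<in> Stab u"
        using xy'(5) sub' unfolding Stab_def \<psi>_def
        by (simp add: substitution_comp substitutions subst_stream_comp u_eq)
      moreover have "length (\<psi> [L0]) < length (\<phi> [L0])"
        using xy' xy by (simp add: \<psi>_def \<phi> uniform_length[OF uniform_\<mu>] uniform_length[OF uniform_\<rho>])
      ultimately have IH: "(\<exists>i. \<psi> = \<sigma> ^^ i) \<or> (\<exists>j. \<psi> = \<tau> ^^ j)"
        using less.hyps by blast
      have "\<phi> = \<mu> \<circ> (\<rho> \<circ> morphism_of x' y')"
        unfolding \<phi> xy(3,4) xy'(3,4) by (simp add: \<mu>_def \<rho>_def morphism_of_comp)
      then have \<phi>_eq: "\<phi> = \<sigma> \<circ> \<psi>"
        by (metis \<psi>_def \<sigma>_\<mu> comp_assoc)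
      from IH show ?thesis
      proof (elim disjE exE)
        fix i assume "\<psi> = \<sigma> ^^ i"
        then have "\<phi> = \<sigma> ^^ Suc i" using \<phi>_eq by simp
        then show ?thesis by blast
      next
        fix j assume j: "\<psi> = \<tau> ^^ j"
        show ?thesis
        proof (cases j)
          case 0
          then have "\<phi> = \<sigma> ^^ 1" using \<phi>_eq j by simp
          then show ?thesis by blast
        next
          case (Suc k)
          \<comment> \<open>With at least one \<open>\<tau>\<close> available,
            \<open>\<sigma> \<circ> \<tau> = \<tau> \<circ> \<tau>\<close> turns the leading
            \<open>\<sigma>\<close> into \<open>\<tau>\<close>.\<close>
          then have "\<phi> = \<tau> ^^ Suc j"
            using \<phi>_eq j \<sigma>_\<tau> by (simp add: comp_assoc[symmetric])
          then show ?thesis by blast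
        qed
      qed
    qed
  qed
qed

theorem theorem6p1:
  "Stab u = {\<sigma> ^^ i | i :: nat. True} \<union> {\<tau> ^^ j | j :: nat. True}
          \<union> {\<sigma> \<circ> \<tau> ^^ k | k :: nat. True} \<union> {\<tau> \<circ> \<sigma> ^^ l | l :: nat. True}"
proof
  show "Stab u \<subseteq> {\<sigma> ^^ i | i :: nat. True} \<union> {\<tau> ^^ j | j :: nat. True}
          \<union> {\<sigma> \<circ> \<tau> ^^ k | k :: nat. True} \<union> {\<tau> \<circ> \<sigma> ^^ l | l :: nat. True}"
    using Stab_u_cases by blast
  show "{\<sigma> ^^ i | i :: nat. True} \<union> {\<tau> ^^ j | j :: nat. True}
          \<union> {\<sigma> \<circ> \<tau> ^^ k | k :: nat. True} \<union> {\<tau> \<circ> \<sigma> ^^ l | l :: nat. True} \<subseteq> Stab u"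
    by (auto intro: Stab_funpow Stab_comp \<sigma>_in_Stab \<tau>_in_Stab)
qed

end
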